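(* Let $t\geq 2$ be an integer, $m=4t+2$ and $n=2^m+1$. Put $\delta_1=\frac{n}{5}$, $\delta_2=2^{4t-1}+\frac{2^{4t}-1}{5}$, $\delta_3=\delta_2-6$; if $t=2$ put $\delta_4=\delta_2-8$, $\delta_5=\delta_2-24$, and if $t>2$ put $\delta_4=\delta_2-96$, $\delta_5=\delta_2-102$. Then $\delta_1,\delta_2,\delta_3,\delta_4,\delta_5$ are respectively the first, second, third, fourth and fifth largest coset leaders modulo $n$ (i.e. they are coset leaders, and every coset leader $x$ with $\delta_5<x\leq n-1$ belongs to $\{\delta_1,\delta_2,\delta_3,\delta_4\}$).
   Context: For $n=2^m+1$ and an integer $x$, the 2-cyclotomic coset of $x$ modulo $n$ is $C_x=\{x\cdot 2^{j} \bmod n : j\geq 0\}\subseteq\{0,1,\dots,n-1\}$. For $0\leq x\leq n-1$, "$x$ is a coset leader" means that $x$ is the smallest element of $C_x$. *)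

theory Defs
  imports Main
begin

definition cyc_coset :: "nat \<Rightarrow> nat \<Rightarrow> nat set" where
  "cyc_coset n x = {(x * 2 ^ j) mod n | j. True}"

definition coset_leader :: "nat \<Rightarrow> nat \<Rightarrow> bool" where
  "coset_leader n x \<longleftrightarrow> x < n \<and> (\<forall>y \<in> cyc_coset n x. x \<le> y)"

end

theory Submission
  imports Defs
begin

text \<open>
  Since \<open>2 ^ m \<equiv> -1\<close> modulo \<open>n\<close>, a positive \<open>x\<close> is a coset leader iff every \<open>x * 2 ^ j\<close> with
  \<open>j < m\<close> has distance at least \<open>x\<close> from the multiples of \<open>n\<close>. The cases \<open>j \<le> 2\<close> force \<open>x \<le> n / 5\<close>.
  If \<open>7 n / 40 < x < n / 5\<close>, then multiplication by 4, read up to sign, sends an orbit point of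
  \<open>[x, n / 5)\<close> above \<open>n / 5\<close>, and the next multiplication sends it back; as \<open>m div 2\<close> is odd,
  \<open>x * 2 ^ m \<equiv> -x\<close> would have to lie above \<open>n / 5\<close>, a contradiction. Hence the largest leaders are
  \<open>n / 5\<close> and numbers \<open>\<delta>\<^sub>2 - c\<close> with \<open>c \<ge> 0\<close>, where \<open>\<delta>\<^sub>2 = \<lfloor>7 n / 40\<rfloor>\<close>. For small \<open>c\<close>, being a
  leader is decided by the last few \<open>j < m\<close>, that is, by the residues of \<open>x\<close> modulo small powers of 2.
\<close>

section \<open>Distance from the multiples of \<open>n\<close> and the leader criterion\<close>

text \<open>For \<open>x > 0\<close>: \<open>z\<close> has distance at least \<open>x\<close> from
  every multiple of \<open>n\<close>. The explicit quotient \<open>q\<close> lets an instance be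
  shown by naming \<open>q\<close> and comparing linear expressions, even when \<open>n\<close>
  contains a parameter.\<close>

definition clear :: "int \<Rightarrow> int \<Rightarrow> int \<Rightarrow> bool" where
  "clear n x z \<longleftrightarrow> (\<exists>q. x \<le> z - q * n \<and> z - q * n \<le> n - x)"

lemma clearI: "x \<le> z - q * n \<Longrightarrow> z - q * n \<le> n - x \<Longrightarrow> clear n x z"
  unfolding clear_def by blast

lemma clear_iff_mod:
  assumes "0 < x"
  shows "clear n x z \<longleftrightarrow> x \<le> z mod n \<and> z mod n \<le> n - x"
proof
  assume "clear n x z"
  then obtain q where q: "x \<le> z - q * n" "z - q * n \<le> n - x"
    unfolding clear_def by blast
  have "z mod n = (z - q * n) mod n"
    by (simp add: mod_diff_eq[symmetric])
  also have "\<dots> = z - q * n"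
    using q assms by (intro mod_pos_pos_trivial) auto
  finally show "x \<le> z mod n \<and> z mod n \<le> n - x"
    using q by simp
next
  assume "x \<le> z mod n \<and> z mod n \<le> n - x"
  then show "clear n x z"
    by (intro clearI[where q = "z div n"]) (simp_all add: minus_div_mult_eq_mod)
qed

lemma clear_cong:
  assumes "clear n x z" "n dvd z' - z"
  shows "clear n x z'"
proof -
  obtain q where q: "x \<le> z - q * n" "z - q * n \<le> n - x"
    using assms(1) unfolding clear_def by blast
  obtain k where "z' - z = n * k"
    using assms(2) by blast
  then have "z' - (q + k) * n = z - q * n"
    by (simp add: algebra_simps)
  then show ?thesis
    using q by (intro clearI[where q = "q + k"]) simp_all
qed

lemma clear_uminus:
  assumes "clear n x z"
  shows "clear n x (- z)"
proof -
  obtain q where "x \<le> z - q * n" "z - q * n \<le> n - x"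
    using assms unfolding clear_def by blast
  then show ?thesis
    by (intro clearI[where q = "- q - 1"]) (simp_all add: algebra_simps)
qed

lemma clear_cong_uminus:
  assumes "clear n x z" "n dvd z' + z"
  shows "clear n x z'"
  using clear_cong[OF clear_uminus[OF assms(1)]] assms(2) by simp

lemma clear_cases:
  assumes "clear n x z" "0 < x" "0 \<le> z" "z < 2 * n"
  shows "z \<le> n - x \<or> n + x \<le> z"
proof (cases "z < n")
  case True
  then show ?thesis
    using assms clear_iff_mod[of x n z] by simp
next
  case False
  then have "z mod n = z - n"
    using assms(4) by (metis diff_add_cancel diff_ge_0_iff_ge
        linorder_not_less mod_add_self2 mod_pos_pos_trivial mult_2 add_less_cancel_right)
  then show ?thesis
    using assms clear_iff_mod[of x n z] by simp
qed

text \<open>The coset is closed under negation, since \<open>x * 2 ^ (j + m)\<close> is congruent to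
  \<open>- x * 2 ^ j\<close>; minimality at exponent \<open>j + m\<close> is therefore the upper
  bound in \<open>clear\<close> at \<open>j\<close>. The same congruence carries
  \<open>clear\<close> from exponents below \<open>m\<close> to all exponents.\<close>

lemma coset_leader_iff_clear:
  fixes m n x :: nat
  assumes n: "n = 2 ^ m + 1" and "0 < m" and x: "0 < x"
  shows "coset_leader n x \<longleftrightarrow> (\<forall>j<m. clear (int n) (int x) (int x * 2 ^ j))"
proof
  assume L: "coset_leader n x"
  have lower: "int x \<le> (int x * 2 ^ j) mod int n" for j
  proof -
    have "x \<le> (x * 2 ^ j) mod n"
      using L unfolding coset_leader_def cyc_coset_def by blast
    then have "int x \<le> int ((x * 2 ^ j) mod n)"
      by simp
    then show ?thesis
      by (simp add: zmod_int)
  qed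
  have "clear (int n) (int x) (int x * 2 ^ j)" for j
  proof -
    let ?r = "(int x * 2 ^ j) mod int n"
    have "?r > 0"
      using lower[of j] x by linarith
    have "int x * 2 ^ (j + m) = - (int x * 2 ^ j) + int x * 2 ^ j * int n"
      using n by (simp add: power_add algebra_simps)
    then have "(int x * 2 ^ (j + m)) mod int n = (- (int x * 2 ^ j)) mod int n"
      by (metis mod_mult_self1 mult.commute)
    also have "\<dots> = int n - ?r"
      using \<open>?r > 0\<close> by (simp add: zmod_zminus1_eq_if)
    finally have "int x \<le> int n - ?r"
      using lower[of "j + m"] by simp
    then show ?thesis
      using lower[of j] x clear_iff_mod[of "int x"] by simp
  qed
  then show "\<forall>j<m. clear (int n) (int x) (int x * 2 ^ j)"
    by blast
next
  assume C: "\<forall>j<m. clear (int n) (int x) (int x * 2 ^ j)"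
  have all: "clear (int n) (int x) (int x * 2 ^ j)" for j
  proof (induction j rule: less_induct)
    case (less j)
    show ?case
    proof (cases "j < m")
      case True
      then show ?thesis using C by blast
    next
      case False
      then obtain i where i: "j = i + m"
        by (metis add.commute le_Suc_ex linorder_not_less)
      have "int x * 2 ^ j + int x * 2 ^ i = int n * (int x * 2 ^ i)"
        using n i by (simp add: power_add algebra_simps)
      then have "int n dvd int x * 2 ^ j + int x * 2 ^ i"
        by simp
      moreover have "clear (int n) (int x) (int x * 2 ^ i)"
        using less i \<open>0 < m\<close> by simp
      ultimately show ?thesis
        by (rule clear_cong_uminus[rotated])
    qed
  qed
  have "x \<le> y" if y: "y \<in> cyc_coset n x" for y
  proof -
    obtain j where "y = (x * 2 ^ j) mod n"
      using y unfolding cyc_coset_def by blast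
    then have "int y = (int x * 2 ^ j) mod int n"
      by (simp add: zmod_int)
    then show ?thesis
      using all[of j] x clear_iff_mod[of "int x"] by simp
  qed
  moreover have "x < n"
    using all[of 0] x unfolding clear_def by auto
  ultimately show "coset_leader n x"
    unfolding coset_leader_def by blast
qed

lemma coset_leader_clear:
  fixes m n x :: nat
  assumes "n = 2 ^ m + 1" "j < m" "0 < x" "coset_leader n x"
  shows "clear (int n) (int x) (int x * 2 ^ j)"
  using assms coset_leader_iff_clear[of n m x] by auto

section \<open>Upper bounds: \<open>n / 5\<close> and the gap below it\<close>

lemma two_power_4t2: "(2::nat) ^ (4 * t + 2) = 4 * 16 ^ t"
  by (simp add: power_add power_mult)

text \<open>The tests \<open>j = 0, 1, 2\<close> give in turn \<open>2 * x \<le> n\<close>,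
  \<open>3 * x \<le> n\<close>, and then \<open>5 * x \<le> n\<close> or \<open>3 * x = n\<close>;
  the last is impossible since \<open>n\<close> is 2 modulo 3.\<close>

lemma coset_leader_le_fifth:
  fixes t m n x :: nat
  assumes m: "m = 4 * t + 2" and n: "n = 2 ^ m + 1" and L: "coset_leader n x"
  shows "5 * x \<le> n"
\<comment> \<open>The criterion needs \<open>x > 0\<close>, and for \<open>t = 0\<close> the test
  \<open>j = 2\<close> is not below \<open>m = 2\<close>.\<close>
proof (cases "x = 0 \<or> t = 0")
  case True
  show ?thesis
  proof (cases "x = 0")
    case False
    then have "n = 5" "t = 0" using True m n by simp_all
    then have "2 * int x \<le> 5"
      using coset_leader_clear[OF n, of 0 x] m L False by (auto simp: clear_def)
    moreover have "clear 5 (int x) (int x * 2)"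
      using coset_leader_clear[OF n, of 1 x] m L False \<open>n = 5\<close> by simp
    ultimately show ?thesis
      using clear_cases[of 5 "int x" "int x * 2"] False \<open>n = 5\<close> by auto
  qed simp
next
  case False
  then have x: "0 < x" and t: "0 < t" by simp_all
  have C: "clear (int n) (int x) (int x)" "clear (int n) (int x) (int x * 2)" "clear (int n) (int x) (int x * 4)"
    using coset_leader_clear[OF n, of 0 x] coset_leader_clear[OF n, of 1 x]
      coset_leader_clear[OF n, of 2 x] m L x t by simp_all
  have "2 * int x \<le> int n"
    using C(1) unfolding clear_def by auto
  then have "3 * int x \<le> int n"
    using clear_cases[OF C(2)] x by auto
  moreover have "3 * int x \<noteq> int n"
  proof
    assume "3 * int x = int n"
    then have "3 * x = n"
      by linarith
    moreover have "(4 * 16 ^ t + 1) mod 3 = (2::nat)"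
    proof -
      have "16 ^ t mod 3 = (1::nat)"
        by (induction t) (simp_all, presburger)
      then show ?thesis by presburger
    qed
    ultimately show False
      using n m two_power_4t2[of t] by (metis mod_mult_self1_is_0 zero_neq_numeral)
  qed
  ultimately show ?thesis
    using clear_cases[OF C(3)] x by auto
qed

text \<open>The \<open>m\<close> doublings are split into \<open>t\<close> multiplications by 16,
  which up to sign keep the point in \<open>[x, n / 5)\<close>, and a final one by 4, which cannot
  lead to \<open>x\<close> or \<open>- x\<close>.\<close>

lemma coset_leader_gap:
  fixes t m n x :: nat
  assumes m: "m = 4 * t + 2" and n: "n = 2 ^ m + 1"
    and L: "coset_leader n x" and lt: "5 * x < n"
  shows "40 * x \<le> 7 * n"
proof (rule ccontr)
  assume gt: "\<not> 40 * x \<le> 7 * n"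
  define N X where "N = int n" and "X = int x"
  have big: "7 * N < 40 * X" and lt': "5 * X < N"
    using gt lt by (simp_all add: N_def X_def)
  then have X: "0 < X" by linarith
  have C: "clear N X (X * 2 ^ j)" if "j < m" for j
    using coset_leader_clear[OF n that _ L] X by (simp add: N_def X_def)
  have comb: "N dvd a * N + b * u" if "N dvd u" for a b u
    using that by simp
  have low: "\<exists>y. X \<le> y \<and> 5 * y < N \<and> (N dvd X * 16 ^ k - y \<or> N dvd X * 16 ^ k + y)"
    if "k \<le> t" for k
    using that
  proof (induction k)
    case 0
    show ?case
      using lt' by (intro exI[of _ X]) simp
  next
    case (Suc k)
    then obtain y where y: "X \<le> y" "5 * y < N"
      "N dvd X * 16 ^ k - y \<or> N dvd X * 16 ^ k + y"
      by auto
    have "clear N X (X * 16 ^ Suc k)"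
    proof -
      have "4 * Suc k < m"
        using Suc.prems m by simp
      then have "clear N X (X * 2 ^ (4 * Suc k))"
        by (rule C)
      then show ?thesis
        by (simp only: power_mult) simp
    qed
    moreover have "N dvd 4 * N - 16 * y + X * 16 ^ Suc k \<or> N dvd 4 * N - 16 * y - X * 16 ^ Suc k"
    proof -
      have eqs: "4 * N - 16 * y + X * 16 ^ Suc k = 4 * N + 16 * (X * 16 ^ k - y)"
        "4 * N - 16 * y - X * 16 ^ Suc k = 4 * N + (- 16) * (X * 16 ^ k + y)"
        by (simp_all add: algebra_simps)
      show ?thesis
        unfolding eqs using y(3) comb by blast
    qed
    ultimately have "clear N X (4 * N - 16 * y)"
      using clear_cong clear_cong_uminus by blast
    moreover have "0 \<le> 4 * N - 16 * y" "4 * N - 16 * y < 2 * N"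
      using y(1,2) X big by linarith+
    ultimately have far: "4 * N - 16 * y \<le> N - X \<or> N + X \<le> 4 * N - 16 * y"
      using clear_cases X by blast
    \<comment> \<open>\<open>4 * N - 16 * y\<close> lies within \<open>N / 5\<close> of
      \<open>N\<close>; \<open>z\<close> is its signed distance from \<open>N\<close>.\<close>
    define z where "z = 3 * N - 16 * y"
    have "X \<le> \<bar>z\<bar>"
      using far z_def by linarith
    moreover have "- N < 5 * z" "5 * z < N"
      using y(1,2) big z_def by linarith+
    then have "5 * \<bar>z\<bar> < N"
      by linarith
    moreover have "N dvd X * 16 ^ Suc k - z \<or> N dvd X * 16 ^ Suc k + z"
    proof -
      have eqs: "X * 16 ^ Suc k + z = 3 * N + 16 * (X * 16 ^ k - y)"
        "X * 16 ^ Suc k - z = (- 3) * N + 16 * (X * 16 ^ k + y)"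
        by (simp_all add: z_def algebra_simps)
      show ?thesis
        unfolding eqs using y(3) comb by blast
    qed
    then have "N dvd X * 16 ^ Suc k - \<bar>z\<bar> \<or> N dvd X * 16 ^ Suc k + \<bar>z\<bar>"
      by (cases "0 \<le> z") auto
    ultimately show ?case
      by blast
  qed
  obtain y where y: "X \<le> y" "5 * y < N" "N dvd X * 16 ^ t - y \<or> N dvd X * 16 ^ t + y"
    using low by blast
  have N: "N = 4 * 16 ^ t + 1"
    using n m two_power_4t2[of t] by (simp add: N_def)
  \<comment> \<open>The last factor 4 uses \<open>4 * 16 ^ t = N - 1\<close>, so
    \<open>4 * y\<close> would be congruent to \<open>X\<close> or \<open>- X\<close>.\<close>
  have eqs: "X + 4 * y = X * N + (- 4) * (X * 16 ^ t - y)"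
    "4 * y - X = (- X) * N + 4 * (X * 16 ^ t + y)"
    by (simp_all add: N algebra_simps)
  have "N dvd X + 4 * y \<or> N dvd 4 * y - X"
    unfolding eqs using y(3) comb by blast
  moreover have "0 < X + 4 * y" "X + 4 * y < N" "0 < 4 * y - X" "4 * y - X < N"
    using y X lt' by linarith+
  ultimately show False
    using zdvd_not_zless by blast
qed

section \<open>Tests for leaders: \<open>n / 5\<close>, residues modulo powers of 2, points near
  \<open>n / 5\<close>\<close>

text \<open>With \<open>n = 5 * x\<close>, every \<open>x * 2 ^ j\<close> reduces to
  \<open>x * b\<close>, where \<open>b = 2 ^ j mod 5\<close> is nonzero.\<close>

lemma fifth_coset_leader:
  fixes m n x :: nat
  assumes n: "n = 2 ^ m + 1" "0 < m" and x: "5 * x = n"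
  shows "coset_leader n x"
proof -
  have "clear (int n) (int x) (int x * 2 ^ j)" for j
  proof -
    define b where "b = (2::int) ^ j mod 5"
    have "b \<noteq> 0"
      unfolding b_def by (induction j) (simp_all, presburger)
    moreover have "0 \<le> b" "b < 5"
      by (simp_all add: b_def)
    ultimately have b: "b \<in> {1, 2, 3, 4}"
      by auto
    have "int x * 2 ^ j - (2 ^ j div 5) * int n = int x * (2 ^ j - (2 ^ j div 5) * 5)"
      using x by (auto simp: algebra_simps)
    also have "\<dots> = int x * b"
      by (simp add: b_def minus_div_mult_eq_mod)
    finally show ?thesis
      using b x by (intro clearI[where q = "2 ^ j div 5"]) auto
  qed
  moreover have "0 < x"
    using n x by (cases x) auto
  ultimately show ?thesis
    using coset_leader_iff_clear[OF n] by blast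
qed

text \<open>The orbit point tested is \<open>x * 2 ^ (m - i) \<equiv> \<plusminus>(r * n \<mp> x) / 2 ^ i\<close>.\<close>

lemma coset_leader_residue:
  fixes i r m n x :: nat
  assumes n: "n = 2 ^ m + 1" and im: "i \<le> m" "0 < i" and L: "coset_leader n x"
    and r: "r * n < (2 ^ i - 1) * x"
  shows "x mod 2 ^ i \<noteq> r" "(x + r) mod 2 ^ i \<noteq> 0"
proof -
  have x: "0 < x"
    using r by (cases x) auto
  have "m > 0" using im by simp
  have pow: "(2::int) ^ i * 2 ^ (m - i) = 2 ^ m"
    using im by (simp flip: power_add)
  have C: "clear (int n) (int x) (int x * 2 ^ (m - i))"
    using coset_leader_clear[OF n _ x L] im by simp
  have r': "int r * int n + int x < 2 ^ i * int x"
  proof -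
    have "int (r * n) < int ((2 ^ i - 1) * x)"
      using r by linarith
    then have "int r * int n < (2 ^ i - 1) * int x" by simp
    then show ?thesis by (simp add: algebra_simps)
  qed
  \<comment> \<open>The contradiction in both parts: a point of the orbit, up to sign, closer than
    \<open>x\<close> to 0.\<close>
  have far: False if y: "int n dvd int x * 2 ^ (m - i) - y \<or> int n dvd int x * 2 ^ (m - i) + y"
    "0 \<le> y" "y < int x" for y
  proof -
    have "clear (int n) (int x) y"
      using y(1) C clear_cong clear_cong_uminus
      by (metis add.commute dvd_minus_iff minus_diff_eq)
    moreover have "2 * int x \<le> int n"
      using coset_leader_clear[OF n \<open>m > 0\<close> x L] by (auto simp: clear_def)
    ultimately show False
      using y x clear_iff_mod[of "int x" "int n" y] by simp
  qed
  show "x mod 2 ^ i \<noteq> r"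
  proof
    assume "x mod 2 ^ i = r"
    then obtain a where a: "x = 2 ^ i * a + r"
      by (metis mult_div_mod_eq)
    define y where "y = int r * 2 ^ (m - i) - int a"
    have "2 ^ i * y = int r * (int n - 1) - (int x - int r)"
      using pow a n by (simp add: y_def algebra_simps)
    then have y: "2 ^ i * y = int r * int n - int x"
      by (simp add: algebra_simps)
    have "int x * 2 ^ (m - i) - y = int a * int n"
      using pow a n by (simp add: y_def algebra_simps)
    then have d: "int n dvd int x * 2 ^ (m - i) - y" by simp
    then have d': "int n dvd int x * 2 ^ (m - i) + (- y)" by simp
    have "2 ^ i * y < 2 ^ i * int x"
      using y r' by linarith
    then have "y < int x" by simp
    moreover have "- y < int x"
    proof -
      have "2 ^ i * (- y) = int x - int r * int n"
        using y by simp
      also have "\<dots> \<le> int x"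
        by simp
      also have "\<dots> < 2 ^ i * int x"
        using x im by simp
      finally show ?thesis by (simp only: mult_less_cancel_left_pos zero_less_power zero_less_numeral)
    qed
    \<comment> \<open>As \<open>r = 0\<close> is allowed, the sign of \<open>y\<close> is open;
      whichever of \<open>y\<close> and \<open>- y\<close> is nonnegative is too close to 0.\<close>
    ultimately show False
      using far[of y] far[of "- y"] d d' by linarith
  qed
  show "(x + r) mod 2 ^ i \<noteq> 0"
  proof
    assume "(x + r) mod 2 ^ i = 0"
    then obtain a where a: "x + r = 2 ^ i * a"
      by (metis mult_div_mod_eq add_0_right)
    then have a': "int x = 2 ^ i * int a - int r"
      by (metis add_diff_cancel_right' of_nat_add of_nat_mult of_nat_numeral of_nat_power)
    define y where "y = int r * 2 ^ (m - i) + int a"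
    have y: "2 ^ i * y = int r * int n + int x"
      using pow a' n by (simp add: y_def algebra_simps)
    have "int x * 2 ^ (m - i) + y = int a * (2 ^ i * 2 ^ (m - i)) + int a"
      unfolding a' y_def by (simp add: algebra_simps)
    also have "\<dots> = int a * int n"
      unfolding pow using n by (simp add: algebra_simps)
    finally have "int x * 2 ^ (m - i) + y = int a * int n" .
    then have "int n dvd int x * 2 ^ (m - i) + y" by simp
    moreover have "2 ^ i * y < 2 ^ i * int x"
      using y r' by linarith
    then have "y < int x" by simp
    moreover have "0 \<le> y" by (simp add: y_def)
    ultimately show False
      using far by blast
  qed
qed

text \<open>
  Multiplying \<open>v = (n - e) / 5\<close> by 16 modulo \<open>n\<close> yields \<open>(n - 16 * e) / 5\<close>, so the orbit stays near
  the orbit of \<open>n / 5\<close> as long as the error has not grown beyond \<open>n / 8\<close>.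
\<close>

lemma clear_near_fifth:
  fixes n x v e :: int
  assumes "0 < x" "5 * x \<le> n" "40 * x \<le> 7 * n" "5 * v = n - e" "0 \<le> e"
    "8 * 16 ^ k * e \<le> n" "j < 4 * Suc k"
  shows "clear n x (v * 2 ^ j)"
  using assms
proof (induction k arbitrary: v e j)
  case 0
  then have "j = 0 \<or> j = 1 \<or> j = 2 \<or> j = 3" by auto
  \<comment> \<open>For \<open>j = 0\<close> the bound is \<open>v \<ge> 7 * n / 40 \<ge> x\<close>,
    from \<open>8 * e \<le> n\<close>. The quotient 1 is for \<open>j = 3\<close>, as
    \<open>8 * v\<close> exceeds \<open>n\<close>.\<close>
  then show ?case
    using 0 by (auto intro: clearI[where q = 0] clearI[where q = 1])
next
  case (Suc k)
  have "8 * e \<le> 8 * 16 ^ Suc k * e"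
    using Suc.prems(5) mult_right_mono[of 1 "16 ^ Suc k :: int" "8 * e"]
      one_le_power[of "16::int" "Suc k"] by simp
  then have le: "8 * e \<le> n"
    using Suc.prems(6) by linarith
  show ?case
  proof (cases "j < 4")
    case True
    then have "j = 0 \<or> j = 1 \<or> j = 2 \<or> j = 3" by auto
    then show ?thesis
      using Suc.prems(1-5) le by (auto intro: clearI[where q = 0] clearI[where q = 1])
  next
    case False
    then obtain i where i: "j = i + 4"
      by (metis add.commute le_Suc_ex linorder_not_less)
    have "clear n x ((16 * v - 3 * n) * 2 ^ i)"
      by (rule Suc.IH[where e = "16 * e"]) (use Suc.prems i in auto)
    moreover have "v * 2 ^ j - (16 * v - 3 * n) * 2 ^ i = n * (3 * 2 ^ i)"
      by (simp add: i power_add algebra_simps)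
    then have "n dvd v * 2 ^ j - (16 * v - 3 * n) * 2 ^ i"
      by simp
    ultimately show ?thesis
      by (rule clear_cong)
  qed
qed

section \<open>The case \<open>t \<ge> 3\<close>: candidates just below \<open>d2\<close>\<close>

text \<open>Powers of 16 are 1 modulo 5. The parameter \<open>p\<close> makes \<open>n\<close> and
  \<open>d2\<close> linear, so that later comparisons are linear in \<open>p\<close>; the
  coefficient 14336 of \<open>d2\<close> is a multiple of \<open>2 ^ 8\<close>, so residues of
  \<open>d2\<close> modulo \<open>2 ^ 8\<close> do not depend on \<open>p\<close>.\<close>

lemma linear_parameter:
  fixes t m n d2 :: nat
  assumes t: "3 \<le> t" and m: "m = 4 * t + 2" and n: "n = 2 ^ m + 1"
    and d2: "d2 = 2 ^ (4 * t - 1) + (2 ^ (4 * t) - 1) div 5"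
  obtains p where "16 ^ (t - 3) = 5 * p + 1" "n = 81920 * p + 16385" "d2 = 14336 * p + 2867"
proof -
  obtain s where s: "t = s + 3"
    using t by (metis add.commute le_Suc_ex)
  have "16 ^ s mod 5 = (1::nat)"
    by (induction s) (simp_all, presburger)
  then obtain p where p: "(16::nat) ^ s = 5 * p + 1"
    by (metis mult_div_mod_eq)
  have e: "(2::nat) ^ (4 * s) = 5 * p + 1"
    using p by (simp add: power_mult)
  have "4 * t - 1 = 4 * s + 11" "4 * t = 4 * s + 12" "m = 4 * s + 14"
    using s m by simp_all
  then have "n = 81920 * p + 16385" "d2 = 2048 * (5 * p + 1) + (20480 * p + 4095) div 5"
    using n d2 e by (simp_all only: power_add) simp_all
  then show thesis
    using that[of p] p s by simp
qed

text \<open>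
  With \<open>16 ^ (t - 3) = 5 * p + 1\<close>, the multiplier in \<open>tail\<close> is congruent to \<open>x * 2 ^ (4 * t - 6)\<close>,
  that is, to \<open>(n - 8 * (15 + 40 * c) * (5 * p + 1)) / 5\<close>.
\<close>

lemma coset_leader_from_tail:
  fixes t m n p c x :: nat
  assumes t: "3 \<le> t" and m: "m = 4 * t + 2" and n: "n = 2 ^ m + 1"
    and p: "16 ^ (t - 3) = 5 * p + 1" "n = 81920 * p + 16385"
    and c: "c \<le> 102" and x: "x = 14336 * p + 2867 - c"
    and tail: "\<And>a. a < 8 \<Longrightarrow>
      clear (int n) (int x) (((16264 - 320 * int c) * int p + (3253 - 64 * int c)) * 2 ^ a)"
  shows "coset_leader n x"
proof -
  define s where "s = t - 3"
  have s: "16 ^ s = 5 * int p + 1"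
    using arg_cong[OF p(1), of int] by (simp add: s_def)
  have X: "int x = 14336 * int p + 2867 - int c" and N: "int n = 81920 * int p + 16385"
    using c x p by auto
  have "clear (int n) (int x) (int x * 2 ^ j)" if j: "j < m" for j
  proof -
    \<comment> \<open>\<open>m = 6 + 4 * s + 8\<close>: a start near \<open>7 * n / 40\<close>, a
      stretch near the orbit of \<open>n / 5\<close>, and the tail.\<close>
    consider "j < 6" | i where "j = i + 6" "i < 4 * s"
      | a where "j = a + 4 * s + 6" "a < 8"
    proof -
      have "j < 6 \<or> (j = (j - 6) + 6 \<and> j - 6 < 4 * s)
        \<or> (j = (j - 4 * s - 6) + 4 * s + 6 \<and> j - 4 * s - 6 < 8)"
        using j t m by (auto simp: s_def)
      then show thesis
        using that by blast
    qed
    then show ?thesis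
    proof cases
      case 1
      then have "j = 0 \<or> j = 1 \<or> j = 2 \<or> j = 3 \<or> j = 4 \<or> j = 5" by auto
      then show ?thesis
        using X N c
        by (auto intro: clearI[where q = 0] clearI[where q = 1] clearI[where q = 2] clearI[where q = 5])
    next
      case 2
      then obtain k where k: "s = Suc k"
        by (cases "s") auto
      \<comment> \<open>Here \<open>64 * x - 11 * n = (n - e) / 5\<close>. The bound
        \<open>c \<le> 102\<close> gives \<open>e \<le> 32760\<close>, just small enough for
        \<open>8 * 16 ^ k * e \<le> n\<close>.\<close>
      define e :: int where "e = 8 * (15 + 40 * int c)"
      have "8 * 16 ^ k * e \<le> 8 * 16 ^ k * 32760"
        using c by (intro mult_left_mono) (simp_all add: e_def)
      also have "\<dots> \<le> int n"
        using s k N by simp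
      finally have "clear (int n) (int x) ((64 * int x - 11 * int n) * 2 ^ i)"
        using 2 k X N c by (intro clear_near_fifth[where e = e and k = k]) (simp_all add: e_def)
      moreover have "int x * 2 ^ j - (64 * int x - 11 * int n) * 2 ^ i = int n * (11 * 2 ^ i)"
        by (simp add: 2 power_add algebra_simps)
      then have "int n dvd int x * 2 ^ j - (64 * int x - 11 * int n) * 2 ^ i"
        by simp
      ultimately show ?thesis
        by (rule clear_cong)
    next
      case 3
      let ?w = "(16264 - 320 * int c) * int p + (3253 - 64 * int c)"
      have "(2::int) ^ (4 * s) = 5 * int p + 1"
        using s by (simp add: power_mult)
      then have "int x * 2 ^ j - ?w * 2 ^ a = 2 ^ a * (64 * (5 * int p + 1) * int x - ?w)"
        by (simp add: 3 power_add algebra_simps)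
      also have "64 * (5 * int p + 1) * int x - ?w = int n * (56 * int p + 11)"
        unfolding X N by (simp add: algebra_simps)
      finally have "int n dvd int x * 2 ^ j - ?w * 2 ^ a" by simp
      then show ?thesis
        by (rule clear_cong[OF tail[OF 3(2)]])
    qed
  qed
  moreover have "0 < x" "0 < m"
    using x c m by auto
  ultimately show ?thesis
    using coset_leader_iff_clear[OF n] by blast
qed

text \<open>Only the eight tail doublings remain. Each \<open>q\<close> is the floor of the tail
  point divided by \<open>n\<close>, the same for every \<open>p\<close>; it is negative for
  \<open>c = 96\<close> and \<open>c = 102\<close>, where the multiplier is negative.\<close>

lemma four_coset_leaders:
  fixes t m n p c x :: nat
  assumes t: "3 \<le> t" and m: "m = 4 * t + 2" and n: "n = 2 ^ m + 1"
    and p: "16 ^ (t - 3) = 5 * p + 1" "n = 81920 * p + 16385"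
    and c: "c \<in> {0, 6, 96, 102}" and x: "x = 14336 * p + 2867 - c"
  shows "coset_leader n x"
proof (rule coset_leader_from_tail[OF t m n p _ x])
  show "c \<le> 102" using c by auto
  then have X: "int x = 14336 * int p + 2867 - int c" and N: "int n = 81920 * int p + 16385"
    using x p by auto
  fix a :: nat
  assume "a < 8"
  then have a: "a \<in> {0, 1, 2, 3, 4, 5, 6, 7}" by auto
  show "clear (int n) (int x) (((16264 - 320 * int c) * int p + (3253 - 64 * int c)) * 2 ^ a)"
    using c
  proof (elim insertE emptyE)
    assume c: "c = 0"
    show ?thesis
      using a unfolding X N c
      by (elim insertE emptyE)
        (simp_all, rule clearI[where q = "0"], simp, simp,
         rule clearI[where q = "0"], simp, simp,
         rule clearI[where q = "0"], simp, simp,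
         rule clearI[where q = "1"], simp, simp,
         rule clearI[where q = "3"], simp, simp,
         rule clearI[where q = "6"], simp, simp,
         rule clearI[where q = "12"], simp, simp,
         rule clearI[where q = "25"], simp, simp)
  next
    assume c: "c = 6"
    show ?thesis
      using a unfolding X N c
      by (elim insertE emptyE)
        (simp_all, rule clearI[where q = "0"], simp, simp,
         rule clearI[where q = "0"], simp, simp,
         rule clearI[where q = "0"], simp, simp,
         rule clearI[where q = "1"], simp, simp,
         rule clearI[where q = "2"], simp, simp,
         rule clearI[where q = "5"], simp, simp,
         rule clearI[where q = "11"], simp, simp,
         rule clearI[where q = "22"], simp, simp)
  next
    assume c: "c = 96"
    show ?thesis
      using a unfolding X N c
      by (elim insertE emptyE)
        (simp_all, rule clearI[where q = "-1"], simp, simp,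
         rule clearI[where q = "-1"], simp, simp,
         rule clearI[where q = "-1"], simp, simp,
         rule clearI[where q = "-2"], simp, simp,
         rule clearI[where q = "-3"], simp, simp,
         rule clearI[where q = "-6"], simp, simp,
         rule clearI[where q = "-12"], simp, simp,
         rule clearI[where q = "-23"], simp, simp)
  next
    assume c: "c = 102"
    show ?thesis
      using a unfolding X N c
      by (elim insertE emptyE)
        (simp_all, rule clearI[where q = "-1"], simp, simp,
         rule clearI[where q = "-1"], simp, simp,
         rule clearI[where q = "-1"], simp, simp,
         rule clearI[where q = "-2"], simp, simp,
         rule clearI[where q = "-4"], simp, simp,
         rule clearI[where q = "-7"], simp, simp,
         rule clearI[where q = "-13"], simp, simp,
         rule clearI[where q = "-26"], simp, simp)
  qed
qed

text \<open>Since \<open>x\<close> is congruent to \<open>307 - c\<close> modulo 256, the residue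
  conditions depend on \<open>c\<close> alone, and a finite check over \<open>c < 102\<close>
  suffices.\<close>

lemma no_other_coset_leaders:
  fixes t m n p c x :: nat
  assumes t: "3 \<le> t" and m: "m = 4 * t + 2" and n: "n = 2 ^ m + 1"
    and p: "n = 81920 * p + 16385" and c: "c < 102" and x: "x + c = 14336 * p + 2867"
    and L: "coset_leader n x"
  shows "c \<in> {0, 6, 96}"
proof -
  have R: "x mod 2 ^ i \<noteq> r \<and> (x + r) mod 2 ^ i \<noteq> 0"
    if "0 < i" "i \<le> 8" "r * n < (2 ^ i - 1) * x" for i r
    using coset_leader_residue[OF n _ that(1) L that(3)] that(2) m t by simp
  \<comment> \<open>Pairs \<open>(i, r)\<close> with \<open>r / (2 ^ i - 1)\<close> below
    \<open>x / n\<close>, which is slightly under \<open>7 / 40\<close>; together they exclude every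
    other \<open>c\<close>.\<close>
  define K :: "(nat \<times> nat) list"
    where "K = [(1, 0), (3, 1), (5, 3), (5, 5), (7, 11), (7, 13), (7, 19), (7, 21), (8, 43)]"
  have E: "(307 - c) mod 2 ^ i \<noteq> r \<and> (307 - c + r) mod 2 ^ i \<noteq> 0"
    if ir: "(i, r) \<in> set K" for i r
  proof -
    have i: "0 < i" "i \<le> 8" and "r * n < (2 ^ i - 1) * x"
      using ir x c unfolding K_def p by auto
    then have "x mod 2 ^ i \<noteq> r" "(x + r) mod 2 ^ i \<noteq> 0"
      using R by blast+
    \<comment> \<open>\<open>307 = 51 + 256\<close>: one multiple of 256 is kept back so that
      \<open>307 - c\<close> is not truncated.\<close>
    moreover have "x = 2 ^ i * (2 ^ (8 - i) * (56 * p + 10)) + (307 - c)"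
    proof -
      have "(2::nat) ^ i * 2 ^ (8 - i) = 2 ^ 8"
        using i by (simp flip: power_add)
      then have "2 ^ i * (2 ^ (8 - i) * (56 * p + 10)) = 256 * (56 * p + 10)"
        by (simp flip: mult.assoc)
      then show ?thesis
        using x c by simp
    qed
    ultimately show ?thesis
      by (metis add.assoc mod_mult_self4)
  qed
  have "list_all (\<lambda>c.
      list_all (\<lambda>(i, r). (307 - c) mod 2 ^ i \<noteq> r \<and> (307 - c + r) mod 2 ^ i \<noteq> 0) K
    \<longrightarrow> c \<in> {0, 6, 96}) [0..<102]"
    unfolding K_def by (simp add: upt_conv_Cons)
  moreover have "c \<in> set [0..<102]"
    unfolding set_upt using c by simp
  ultimately show ?thesis
    using E unfolding list_all_iff by blast
qed

section \<open>The case \<open>t = 2\<close> and the conclusion\<close>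

lemma coset_leaders_1025:
  "coset_leader 1025 179" "coset_leader 1025 173" "coset_leader 1025 171" "coset_leader 1025 155"
  "coset_leader 1025 x \<Longrightarrow> 155 < x \<Longrightarrow> x \<le> 179 \<Longrightarrow> x \<in> {179, 173, 171}"
proof -
  have n: "(1025::nat) = 2 ^ 10 + 1" by simp
  have iff: "coset_leader 1025 y \<longleftrightarrow>
      list_all (\<lambda>j. y \<le> (y * 2 ^ j) mod 1025 \<and> (y * 2 ^ j) mod 1025 + y \<le> 1025) [0..<10]" if "0 < y" for y
  proof -
    have "clear (int 1025) (int y) (int y * 2 ^ j) \<longleftrightarrow>
        y \<le> (y * 2 ^ j) mod 1025 \<and> (y * 2 ^ j) mod 1025 + y \<le> 1025" for j
    proof -
      have "(int y * 2 ^ j) mod int 1025 = int ((y * 2 ^ j) mod 1025)"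
        by (simp add: zmod_int)
      then show ?thesis
        using that clear_iff_mod[of "int y" "int 1025" "int y * 2 ^ j"] by auto
    qed
    then show ?thesis
      using coset_leader_iff_clear[OF n _ that] by (auto simp: list_all_iff)
  qed
  show "coset_leader 1025 179" "coset_leader 1025 173" "coset_leader 1025 171" "coset_leader 1025 155"
    by (simp_all add: iff upt_conv_Cons)
  have "list_all (\<lambda>y. coset_leader 1025 y \<longrightarrow> y \<in> {179, 173, 171}) [156..<180]"
    by (simp add: iff upt_conv_Cons)
  moreover assume L: "coset_leader 1025 x" and "155 < x" "x \<le> 179"
  then have "x \<in> set [156..<180]"
    unfolding set_upt by simp
  ultimately show "x \<in> {179, 173, 171}"
    using L unfolding list_all_iff by blast
qed

theorem theorem4p5:
  fixes t m n d1 d2 d3 d4 d5 :: nat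
  assumes "t \<ge> 2"
    and "m = 4 * t + 2"
    and "n = 2 ^ m + 1"
    and "d1 = n div 5"
    and "d2 = 2 ^ (4 * t - 1) + (2 ^ (4 * t) - 1) div 5"
    and "d3 = d2 - 6"
    and "d4 = (if t = 2 then d2 - 8 else d2 - 96)"
    and "d5 = (if t = 2 then d2 - 24 else d2 - 102)"
  shows "d1 > d2 \<and> d2 > d3 \<and> d3 > d4 \<and> d4 > d5
    \<and> coset_leader n d1 \<and> coset_leader n d2 \<and> coset_leader n d3
    \<and> coset_leader n d4 \<and> coset_leader n d5
    \<and> (\<forall>x. coset_leader n x \<and> d5 < x \<and> x \<le> n - 1 \<longrightarrow> x \<in> {d1, d2, d3, d4})"
proof (cases "t = 2")
  case True
  then have n: "n = 1025" and d: "d1 = 205" "d2 = 179" "d3 = 173" "d4 = 171" "d5 = 155"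
    using assms by simp_all
  have "coset_leader n d1"
    by (rule fifth_coset_leader[OF assms(3)]) (use assms(2) n d in simp_all)
  moreover have "x \<in> {d1, d2, d3, d4}" if L: "coset_leader n x" and x: "d5 < x" for x
  proof (cases "x = d1")
    case False
    then have "5 * x < n"
      using coset_leader_le_fifth[OF assms(2,3) L] n d by simp
    then have "x \<le> 179"
      using coset_leader_gap[OF assms(2,3) L] n by simp
    then show ?thesis
      using coset_leaders_1025(5)[of x] L x n d by simp
  qed simp
  ultimately show ?thesis
    using coset_leaders_1025(1-4) n d by simp
next
  case False
  then have t: "3 \<le> t"
    using assms(1) by simp
  obtain p where p: "16 ^ (t - 3) = 5 * p + 1" "n = 81920 * p + 16385" "d2 = 14336 * p + 2867"
    using linear_parameter[OF t assms(2,3,5)] .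
  have d: "d1 = 16384 * p + 3277" "d3 = d2 - 6" "d4 = d2 - 96" "d5 = d2 - 102"
    using assms(4,6,7,8) False p by simp_all
  have "coset_leader n d1"
    by (rule fifth_coset_leader[OF assms(3)]) (use assms(2) p d in simp_all)
  moreover have leader: "coset_leader n (d2 - c)" if c: "c \<in> {0, 6, 96, 102}" for c
    by (rule four_coset_leaders[OF t assms(2,3) p(1,2) c]) (simp add: p)
  moreover have "x \<in> {d1, d2, d3, d4}" if L: "coset_leader n x" and x: "d5 < x" for x
  proof (cases "x = d1")
    case False
    then have "5 * x < n"
      using coset_leader_le_fifth[OF assms(2,3) L] p d by simp
    \<comment> \<open>\<open>d2\<close> is the floor of \<open>7 * n / 40\<close>, the bound given
      by the gap.\<close>
    then have "x \<le> d2"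
      using coset_leader_gap[OF assms(2,3) L] p by simp
    then have "d2 - x \<in> {0, 6, 96}"
      using x p d L by (intro no_other_coset_leaders[OF t assms(2,3) p(2)]) simp_all
    then show ?thesis
      using \<open>x \<le> d2\<close> x d by auto
  qed simp
  ultimately show ?thesis
    using leader[of 0] leader[of 6] leader[of 96] leader[of 102] p d by simp
qed

end
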